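(* Let $G$ be a finite simple graph on $n\ge 4$ vertices, and let $\mathbf{Q}=\{Q_1,\dots,Q_m\}$ be any greedy clique decomposition of $G$. Let $\mathcal{F}(\mathbf{Q})=\{S_{\mathbf{Q}}(v): v\in V(G)\}$ be the associated multifamily representation of $G$, and let $\mathcal{F}$ be any representation of $G$ obtained from $\mathcal{F}(\mathbf{Q})$ by successively attaching monopolized elements to the sets which occur repeatedly in $\mathcal{F}(\mathbf{Q})$. Then $\mathcal{F}$ uses at most $\lfloor n^2/4\rfloor$ elements, i.e. $|\mathbf{S}(\mathcal{F})|\le \lfloor n^2/4\rfloor$.
   Context: All graphs are finite, undirected and simple, and may have isolated vertices. A clique of $G$ is a nonempty set of pairwise adjacent vertices. A clique with exactly one vertex is called trivial. For a clique $Q$, $E(Q)$ is the set of edges of $G$ with both ends in $Q$. A clique partition of $G$ is a set of cliques such that every two adjacent vertices lie together in exactly one of the cliques, (automatically) every two distinct nonadjacent vertices lie together in none, and every isolated vertex of $G$ is covered by a trivial clique. A greedy clique decomposition of $G$ is an ordered clique partition $\mathbf{Q}=\{Q_1,\dots,Q_m\}$ obtained by removing maximal cliques one by one until no edges remain: each nontrivial $Q_i$ is a maximal clique (with respect to inclusion) of the graph $G-\bigcup_{j<i}E(Q_j)$, which is obtained from $G$ by deleting the edges in $\bigcup_{j<i}E(Q_j)$ and keeping all vertices. The only trivial cliques in $\mathbf{Q}$ are the cliques $\{v\}$ with $v$ an isolated vertex of $G$ itself, one for each such $v$. A multifamily representation of $G$ is a family $\{S_v : v\in V(G)\}$ of nonempty,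 not necessarily distinct, finite sets such that for all distinct $u,v$, $|S_u\cap S_v|=1$ if $u,v$ are adjacent and $|S_u\cap S_v|=0$ otherwise. It is called a representation of $G$ if the sets $S_v$ are pairwise distinct. For such a family $\mathcal{F}$, $\mathbf{S}(\mathcal{F})=\bigcup_{v}S_v$ is the set of elements it uses. Given $\mathbf{Q}=\{Q_1,\dots,Q_m\}$, associate with each $Q_k$ an element $e_k$ (distinct for distinct $k$) and put $S_{\mathbf{Q}}(v)=\{e_k : v\in Q_k\}$ for $v\in V(G)$. Then $\mathcal{F}(\mathbf{Q})=\{S_{\mathbf{Q}}(v):v\in V(G)\}$ is a multifamily representation of $G$. A monopolized element of a (multi)family $\mathcal F$ is an element of $\mathbf{S}(\mathcal{F})$ that belongs to only one member of $\mathcal{F}$. "Successively attaching monopolized elements to the sets which occur repeatedly" means: for each maximal collection of vertices $v$ having the same set $S_{\mathbf{Q}}(v)$, if the collection has $k\ge 2$ vertices, choose $k-1$ of them and add to the set of each chosen vertex one new element, all the new elements (over all collections) being pairwise distinct and not among $e_1,\dots,e_m$. The sets of all other vertices are left unchanged. The result is a representation $\mathcal{F}$ of $G$. *)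

theory Defs
  imports Main
begin

text \<open>A graph is given by its vertex set and its set of edges, an edge being the set of its two
  ends. The vertices are the members of \<open>V\<close>, so isolated vertices are allowed.\<close>

definition simple_graph :: "'a set \<Rightarrow> 'a set set \<Rightarrow> bool" where
  "simple_graph V E \<longleftrightarrow> finite V \<and> (\<forall>e\<in>E. \<exists>u\<in>V. \<exists>v\<in>V. u \<noteq> v \<and> e = {u, v})"

definition isolated :: "'a set \<Rightarrow> 'a set set \<Rightarrow> 'a \<Rightarrow> bool" where
  "isolated V E v \<longleftrightarrow> v \<in> V \<and> (\<forall>u\<in>V. {u, v} \<notin> E)"

definition clique :: "'a set \<Rightarrow> 'a set set \<Rightarrow> 'a set \<Rightarrow> bool" where
  "clique V E Q \<longleftrightarrow> Q \<noteq> {} \<and> Q \<subseteq> V \<and> (\<forall>u\<in>Q. \<forall>v\<in>Q. u \<noteq> v \<longrightarrow> {u, v} \<in> E)"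

definition trivial_clique :: "'a set \<Rightarrow> bool" where
  "trivial_clique Q \<longleftrightarrow> card Q = 1"

definition maximal_clique :: "'a set \<Rightarrow> 'a set set \<Rightarrow> 'a set \<Rightarrow> bool" where
  "maximal_clique V E Q \<longleftrightarrow> clique V E Q \<and> (\<forall>Q'. clique V E Q' \<and> Q \<subseteq> Q' \<longrightarrow> Q' = Q)"

definition clique_edges :: "'a set set \<Rightarrow> 'a set \<Rightarrow> 'a set set" where
  "clique_edges E Q = {e \<in> E. e \<subseteq> Q}"

definition clique_partition :: "'a set \<Rightarrow> 'a set set \<Rightarrow> 'a set set \<Rightarrow> bool" where
  "clique_partition V E P \<longleftrightarrow>
     (\<forall>Q\<in>P. clique V E Q) \<and>
     (\<forall>u\<in>V. \<forall>v\<in>V. {u, v} \<in> E \<longrightarrow> (\<exists>!Q. Q \<in> P \<and> u \<in> Q \<and> v \<in> Q)) \<and>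
     (\<forall>v. isolated V E v \<longrightarrow> {v} \<in> P)"

text \<open>The order of the cliques is the order of the list. Trivial cliques delete no edges and may
  stand anywhere in the list.\<close>

definition greedy_clique_decomposition :: "'a set \<Rightarrow> 'a set set \<Rightarrow> 'a set list \<Rightarrow> bool" where
  "greedy_clique_decomposition V E Qs \<longleftrightarrow>
     distinct Qs \<and> clique_partition V E (set Qs) \<and>
     (\<forall>i<length Qs. \<not> trivial_clique (Qs ! i) \<longrightarrow>
        maximal_clique V (E - (\<Union>j<i. clique_edges E (Qs ! j))) (Qs ! i)) \<and>
     E - (\<Union>j<length Qs. clique_edges E (Qs ! j)) = {} \<and>
     (\<forall>Q\<in>set Qs. trivial_clique Q \<longrightarrow> (\<exists>v. isolated V E v \<and> Q = {v}))"

text \<open>A family indexed by the vertices is a function, of which only the values on \<open>V\<close> matter.\<close>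

definition multifamily_representation ::
    "'a set \<Rightarrow> 'a set set \<Rightarrow> ('a \<Rightarrow> 'b set) \<Rightarrow> bool" where
  "multifamily_representation V E S \<longleftrightarrow>
     (\<forall>v\<in>V. finite (S v) \<and> S v \<noteq> {}) \<and>
     (\<forall>u\<in>V. \<forall>v\<in>V. u \<noteq> v \<longrightarrow> card (S u \<inter> S v) = (if {u, v} \<in> E then 1 else 0))"

definition representation :: "'a set \<Rightarrow> 'a set set \<Rightarrow> ('a \<Rightarrow> 'b set) \<Rightarrow> bool" where
  "representation V E S \<longleftrightarrow> multifamily_representation V E S \<and> inj_on S V"

definition elements :: "'a set \<Rightarrow> ('a \<Rightarrow> 'b set) \<Rightarrow> 'b set" where
  "elements V S = (\<Union>v\<in>V. S v)"

text \<open>Here \<open>e k\<close> is the element associated with the clique \<open>Qs ! k\<close>; indices start at \<open>0\<close>, and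
  \<open>e\<close> is meant to be injective on \<open>{..<length Qs}\<close>.\<close>

definition clique_family :: "(nat \<Rightarrow> 'b) \<Rightarrow> 'a set list \<Rightarrow> 'a \<Rightarrow> 'b set" where
  "clique_family e Qs v = {e k | k. k < length Qs \<and> v \<in> Qs ! k}"

text \<open>\<open>C\<close> is the set of all chosen vertices and \<open>a v\<close> the new element attached at \<open>v \<in> C\<close>. A
  collection of \<open>k = 1\<close> vertices contains \<open>k - 1 = 0\<close> chosen ones, so the sets that do not
  repeat are unchanged.\<close>

definition attach_monopolized ::
    "'a set \<Rightarrow> ('a \<Rightarrow> 'b set) \<Rightarrow> ('a \<Rightarrow> 'b set) \<Rightarrow> bool" where
  "attach_monopolized V S F \<longleftrightarrow>
     (\<exists>C a. C \<subseteq> V \<and>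
        (\<forall>v\<in>V. card {u \<in> C. S u = S v} = card {u \<in> V. S u = S v} - 1) \<and>
        inj_on a C \<and> a ` C \<inter> elements V S = {} \<and>
        (\<forall>v\<in>V. F v = (if v \<in> C then insert (a v) (S v) else S v)))"

text \<open>For cliques of a graph on \<open>V\<close>, the elements used by \<open>clique_family e Qs\<close> are exactly the
  \<open>e k\<close>, so the attached elements are not among the \<open>e k\<close>.\<close>

lemma elements_clique_family:
  assumes "\<And>Q. Q \<in> set Qs \<Longrightarrow> clique V E Q"
  shows "elements V (clique_family e Qs) = e ` {..<length Qs}"
proof -
  have "\<exists>v\<in>V. v \<in> Qs ! k" if "k < length Qs" for k
    using assms[OF nth_mem[OF that]] by (auto simp: clique_def)
  then show ?thesis unfolding elements_def clique_family_def by blast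
qed

text \<open>\<open>clique_family\<close> of a greedy clique decomposition and the result of attaching monopolized
  elements are (multifamily) representations, as their names in the mathematics presuppose.\<close>

lemma multifamily_representation_clique_family:
  assumes G: "simple_graph V E" and Q: "greedy_clique_decomposition V E Qs"
    and e: "inj_on e {..<length Qs}"
  shows "multifamily_representation V E (clique_family e Qs)"
proof -
  have P: "clique_partition V E (set Qs)" and d: "distinct Qs"
    using Q by (auto simp: greedy_clique_decomposition_def)
  have fin: "finite (clique_family e Qs v)" for v
    by (simp add: clique_family_def)
  have ne: "clique_family e Qs v \<noteq> {}" if v: "v \<in> V" for v
  proof -
    have "\<exists>Q\<in>set Qs. v \<in> Q"
    proof (cases "isolated V E v")
      case True then show ?thesis using P by (auto simp: clique_partition_def)
    next
      case False then show ?thesis using P v unfolding clique_partition_def isolated_def by blast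
    qed
    then show ?thesis by (auto simp: clique_family_def in_set_conv_nth)
  qed
  have 1: "card (clique_family e Qs u \<inter> clique_family e Qs v) = 1"
    if uv: "u \<in> V" "v \<in> V" "{u, v} \<in> E" for u v
  proof -
    have ex1: "\<exists>!Q. Q \<in> set Qs \<and> u \<in> Q \<and> v \<in> Q"
      using P uv unfolding clique_partition_def by blast
    then obtain k where k: "k < length Qs" "u \<in> Qs ! k" "v \<in> Qs ! k"
      by (metis in_set_conv_nth)
    have u: "j = k" if "j < length Qs" "u \<in> Qs ! j" "v \<in> Qs ! j" for j
      using ex1 k that d by (metis nth_eq_iff_index_eq nth_mem)
    have "clique_family e Qs u \<inter> clique_family e Qs v = {e k}"
    proof (intro equalityI subsetI)
      fix x assume "x \<in> clique_family e Qs u \<inter> clique_family e Qs v"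
      then obtain i j where ij: "x = e i" "x = e j" "i < length Qs" "j < length Qs"
        "u \<in> Qs ! i" "v \<in> Qs ! j" unfolding clique_family_def by blast
      then have "i = j" using e by (auto simp: inj_on_def)
      then show "x \<in> {e k}" using ij u by auto
    qed (use k in \<open>auto simp: clique_family_def\<close>)
    then show ?thesis by simp
  qed
  have 0: "clique_family e Qs u \<inter> clique_family e Qs v = {}"
    if uv: "u \<noteq> v" "{u, v} \<notin> E" for u v
  proof (rule ccontr)
    assume "\<not> ?thesis"
    then obtain i j where ij: "e i = e j" "i < length Qs" "j < length Qs"
      "u \<in> Qs ! i" "v \<in> Qs ! j" unfolding clique_family_def by blast
    then have "i = j" using e by (auto simp: inj_on_def)
    moreover have "clique V E (Qs ! i)" using P ij by (auto simp: clique_partition_def)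
    ultimately show False using ij uv by (auto simp: clique_def)
  qed
  show ?thesis unfolding multifamily_representation_def
  proof (intro conjI ballI impI)
    fix u v assume "u \<in> V" "v \<in> V" "u \<noteq> v"
    then show "card (clique_family e Qs u \<inter> clique_family e Qs v) = (if {u, v} \<in> E then 1 else 0)"
      using 0[of u v] 1[of u v] by (cases "{u, v} \<in> E") simp_all
  qed (use fin ne in auto)
qed

lemma representation_attach_monopolized:
  assumes fin: "finite V" and S: "multifamily_representation V E S"
    and F: "attach_monopolized V S F"
  shows "representation V E F"
proof -
  from F obtain C a where C: "C \<subseteq> V"
    and c': "\<forall>v\<in>V. card {u \<in> C. S u = S v} = card {u \<in> V. S u = S v} - 1"
    and a: "inj_on a C" "a ` C \<inter> elements V S = {}"
    and F': "\<forall>v\<in>V. F v = (if v \<in> C then insert (a v) (S v) else S v)"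
    unfolding attach_monopolized_def by (elim exE conjE)
  note c = bspec[OF c'] and F = bspec[OF F']
  have new: "a u \<notin> S v" if "u \<in> C" "v \<in> V" for u v
    using a(2) that by (auto simp: elements_def)
  have int: "F u \<inter> F v = S u \<inter> S v" if "u \<in> V" "v \<in> V" "u \<noteq> v" for u v
  proof -
    have "a u \<noteq> a v" if "u \<in> C" "v \<in> C" using a(1) that \<open>u \<noteq> v\<close> by (auto simp: inj_on_def)
    moreover have "a u \<notin> S v" if "u \<in> C" using new that \<open>v \<in> V\<close> by blast
    moreover have "a v \<notin> S u" if "v \<in> C" using new that \<open>u \<in> V\<close> by blast
    ultimately show ?thesis using F[OF \<open>u \<in> V\<close>] F[OF \<open>v \<in> V\<close>] by auto
  qed
  have m: "multifamily_representation V E F"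
    unfolding multifamily_representation_def
  proof (intro conjI ballI impI)
    fix v assume "v \<in> V"
    with S F show "finite (F v)" "F v \<noteq> {}" by (auto simp: multifamily_representation_def)
  next
    fix u v assume uv: "u \<in> V" "v \<in> V" "u \<noteq> v"
    then have "card (S u \<inter> S v) = (if {u, v} \<in> E then 1 else 0)"
      using S unfolding multifamily_representation_def by blast
    then show "card (F u \<inter> F v) = (if {u, v} \<in> E then 1 else 0)"
      using int[OF uv] by metis
  qed
  have "u = v" if uv: "u \<in> V" "v \<in> V" "F u = F v" for u v
  proof (rule ccontr)
    assume n: "u \<noteq> v"
    have nC: "x \<notin> C" if x: "x \<in> V" "y \<in> V" "F x = F y" "x \<noteq> y" for x y
    proof
      assume "x \<in> C"
      then have "a x \<in> F x" using F x(1) by simp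
      then have "a x \<in> F x \<inter> F y" using x(3) by simp
      then show False using int[OF x(1,2,4)] new[OF \<open>x \<in> C\<close> x(1)] by simp
    qed
    have "u \<notin> C" by (rule nC[OF uv n])
    have "v \<notin> C" by (rule nC[OF uv(2,1) uv(3)[symmetric] n[symmetric]])
    then have s: "S u = S v" using uv F \<open>u \<notin> C\<close> by simp
    have "{w \<in> C. S w = S v} \<subseteq> {w \<in> V. S w = S v} - {u, v}"
      using C \<open>u \<notin> C\<close> \<open>v \<notin> C\<close> by auto
    then have "card {w \<in> C. S w = S v} \<le> card ({w \<in> V. S w = S v} - {u, v})"
      using fin by (intro card_mono) auto
    also have "\<dots> = card {w \<in> V. S w = S v} - 2"
      using n s uv fin by (subst card_Diff_subset) auto
    finally have "card {w \<in> V. S w = S v} \<le> 1" using c[OF uv(2)] by linarith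
    moreover have "card {u, v} \<le> card {w \<in> V. S w = S v}"
      using s uv fin by (intro card_mono) auto
    ultimately show False using n by simp
  qed
  then show ?thesis using m unfolding representation_def inj_on_def by blast
qed

end

theory Submission imports Defs begin

text \<open>
  Greedy removal of maximal cliques never takes more than \<open>n\<^sup>2 div 4\<close> cliques: this is Winkler's
  conjecture, proved by McGuinness.  The theorem follows by applying that bound to only some of the
  cliques, on only some of the vertices.

  \<^emph>\<open>The bound on the number of cliques.\<close>  The relation to exploit is that maximality survives when
  other cliques are dropped from the list, since dropping cliques only removes edges.  So a vertex
  can be deleted together with all cliques through it, and induction on \<open>n\<close> works as soon as some
  vertex lies in at most \<open>n div 2\<close> cliques.  If all cliques have at least three vertices, every
  vertex does, because the cliques through it share no other vertex and each uses up two more.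
  If \<open>{u, v}\<close> is one of the cliques, then at most \<open>n\<close> cliques, counted with multiplicity, pass through \<open>u\<close> and \<open>v\<close>: by
  maximality, each clique through \<open>u\<close> other than \<open>{u, v}\<close> contains a third vertex \<open>x\<close> whose pair
  with \<open>v\<close> is covered by no clique or was removed before its pair with \<open>u\<close> was; likewise with
  \<open>u\<close> and \<open>v\<close> exchanged.  The \<open>n - 2\<close> available vertices are used at most once each: two cliques
  through \<open>u\<close> share nothing else, and a vertex found from both sides would have each of its two
  pairs removed before the other (\<open>degree_sum_two_clique\<close>).

  \<^emph>\<open>The attached elements.\<close>  Two vertices with the same set share only one clique, so this is the
  only clique through either.  Let \<open>U\<close> be the set of vertices that lie in exactly one clique.
  Attaching leaves one vertex unchosen in every class of vertices with equal sets, so the elements of cliques that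
  meet \<open>U\<close>, together with the attached ones, number at most \<open>card U\<close>
  (\<open>card_elements_attach_le\<close>).  The other cliques live on \<open>V - U\<close>, where the bound above applies
  to them.  With \<open>w = card (V - U)\<close> the total is at most \<open>(n - w) + w\<^sup>2 div 4\<close>, which is at
  most \<open>n\<^sup>2 div 4\<close>: the convex function \<open>(n - w) + w\<^sup>2 / 4\<close> is at most \<open>n\<^sup>2 / 4\<close> at both ends \<open>w = 0\<close>
  and \<open>w = n\<close>, the former because \<open>n \<ge> 4\<close>.
\<close>

section \<open>Greedy systems of cliques\<close>

text \<open>
  The graph is left implicit: it is the union of the cliques.  The last clause is the maximality of
  \<open>Q i\<close> at the time of its removal, when exactly the pairs in cliques of index at least \<open>i\<close> are
  still there.  Indices form an arbitrary subset of the naturals so that cliques can be dropped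
  without renumbering.
\<close>

definition greedy_system :: "'a set \<Rightarrow> nat set \<Rightarrow> (nat \<Rightarrow> 'a set) \<Rightarrow> bool" where
  "greedy_system V K Q \<longleftrightarrow> finite V \<and> finite K \<and>
     (\<forall>k\<in>K. Q k \<subseteq> V \<and> 2 \<le> card (Q k)) \<and>
     (\<forall>i\<in>K. \<forall>j\<in>K. \<forall>u v. u \<in> Q i \<inter> Q j \<and> v \<in> Q i \<inter> Q j \<and> u \<noteq> v \<longrightarrow> i = j) \<and>
     (\<forall>i\<in>K. \<forall>w\<in>V - Q i. \<exists>x\<in>Q i. \<forall>j\<in>K. w \<in> Q j \<and> x \<in> Q j \<longrightarrow> j < i)"

definition degree :: "nat set \<Rightarrow> (nat \<Rightarrow> 'a set) \<Rightarrow> 'a \<Rightarrow> nat" where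
  "degree K Q v = card {k \<in> K. v \<in> Q k}"

lemma greedy_systemD:
  assumes "greedy_system V K Q"
  shows "finite V" "finite K" "k \<in> K \<Longrightarrow> Q k \<subseteq> V" "k \<in> K \<Longrightarrow> 2 \<le> card (Q k)"
    "\<lbrakk>i \<in> K; j \<in> K; u \<in> Q i; u \<in> Q j; v \<in> Q i; v \<in> Q j; u \<noteq> v\<rbrakk> \<Longrightarrow> i = j"
    "\<lbrakk>i \<in> K; w \<in> V; w \<notin> Q i\<rbrakk> \<Longrightarrow> \<exists>x\<in>Q i. \<forall>j\<in>K. w \<in> Q j \<and> x \<in> Q j \<longrightarrow> j < i"
  using assms unfolding greedy_system_def by (simp, simp, simp, simp, blast, simp)

lemma greedy_system_subsystem:
  assumes "greedy_system V K Q" "K' \<subseteq> K" "V' \<subseteq> V" "\<And>k. k \<in> K' \<Longrightarrow> Q k \<subseteq> V'"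
  shows "greedy_system V' K' Q"
proof -
  note g = greedy_systemD[OF assms(1)]
  have "\<exists>x\<in>Q i. \<forall>j\<in>K'. w \<in> Q j \<and> x \<in> Q j \<longrightarrow> j < i"
    if "i \<in> K'" "w \<in> V' - Q i" for i w
    using g(6)[of i w] that assms(2,3) by blast
  moreover have "i = j" if "i \<in> K'" "j \<in> K'" "u \<in> Q i \<inter> Q j" "v \<in> Q i \<inter> Q j" "u \<noteq> v" for i j u v
    using g(5)[of i j u v] that assms(2) by blast
  moreover have "finite V'" "finite K'"
    using g(1,2) assms(2,3) finite_subset by blast+
  ultimately show ?thesis
    using assms(2,4) g(4) unfolding greedy_system_def by blast
qed

text \<open>
  This is the witness that a clique \<open>Q k\<close> through \<open>u\<close> contributes.  If \<open>Q k\<close> is removed before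
  \<open>{u, v}\<close>, it comes from the maximality of \<open>Q k\<close>, which \<open>v\<close> does not extend; if \<open>Q k\<close> is removed
  after, from the maximality of \<open>{u, v}\<close>, which no third vertex extends.
\<close>

lemma two_clique_witness:
  assumes sys: "greedy_system V K Q" and i: "i \<in> K" "Q i = {u, v}" "u \<noteq> v"
    and k: "k \<in> K" "k \<noteq> i" "u \<in> Q k"
  shows "\<exists>x\<in>Q k - {u, v}. \<forall>j\<in>K. x \<in> Q j \<and> v \<in> Q j \<longrightarrow> j < k"
proof -
  note g = greedy_systemD[OF sys]
  have v: "v \<in> V" using g(3)[of i] i by auto
  have vk: "v \<notin> Q k" using g(5)[of i k u v] i k by auto
  show ?thesis
  proof (cases "k < i")
    case True
    obtain x where x: "x \<in> Q k" "\<forall>j\<in>K. v \<in> Q j \<and> x \<in> Q j \<longrightarrow> j < k"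
      using g(6)[OF k(1) v vk] by blast
    \<comment> \<open>The pair of \<open>u\<close> and \<open>v\<close> is still there at time \<open>k\<close>.\<close>
    have "x \<noteq> u" using x(2) i True by auto
    then show ?thesis using x vk by auto
  next
    case False
    have "\<not> Q k \<subseteq> {u}"
      using g(4)[OF k(1)] card_mono[of "{u}" "Q k"] by auto
    then obtain x where x: "x \<in> Q k" "x \<noteq> u" by blast
    have xv: "x \<noteq> v" using x vk by auto
    have "x \<in> V" "x \<notin> Q i" using g(3)[OF k(1)] x xv i by auto
    then obtain y where y: "y \<in> {u, v}" "\<forall>j\<in>K. x \<in> Q j \<and> y \<in> Q j \<longrightarrow> j < i"
      using g(6)[OF i(1), of x] i(2) by auto
    \<comment> \<open>The pair of \<open>x\<close> and \<open>u\<close> is removed only with \<open>Q k\<close>, after \<open>Q i\<close>.\<close>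
    have "y \<noteq> u" using y(2) k x False by auto
    then have "\<forall>j\<in>K. x \<in> Q j \<and> v \<in> Q j \<longrightarrow> j < i" using y by auto
    then show ?thesis using x xv False by force
  qed
qed

lemma degree_sum_two_clique:
  assumes sys: "greedy_system V K Q" and i: "i \<in> K" "Q i = {u, v}" "u \<noteq> v"
  shows "degree K Q u + degree K Q v \<le> card V"
proof -
  note g = greedy_systemD[OF sys]
  define A where "A = {k \<in> K. u \<in> Q k} - {i}"
  define B where "B = {k \<in> K. v \<in> Q k} - {i}"
  have "\<forall>k\<in>A. \<exists>x. x \<in> Q k - {u, v} \<and> (\<forall>j\<in>K. x \<in> Q j \<and> v \<in> Q j \<longrightarrow> j < k)"
    using two_clique_witness[OF sys i] unfolding A_def by blast
  then obtain f where f: "\<And>k. k \<in> A \<Longrightarrow> f k \<in> Q k - {u, v}"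
      "\<And>k j. \<lbrakk>k \<in> A; j \<in> K; f k \<in> Q j; v \<in> Q j\<rbrakk> \<Longrightarrow> j < k"
    by metis
  have i': "Q i = {v, u}" "v \<noteq> u" using i by auto
  have "\<forall>k\<in>B. \<exists>x. x \<in> Q k - {v, u} \<and> (\<forall>j\<in>K. x \<in> Q j \<and> u \<in> Q j \<longrightarrow> j < k)"
    using two_clique_witness[OF sys i(1) i'] unfolding B_def by blast
  then obtain h where h: "\<And>k. k \<in> B \<Longrightarrow> h k \<in> Q k - {v, u}"
      "\<And>k j. \<lbrakk>k \<in> B; j \<in> K; h k \<in> Q j; u \<in> Q j\<rbrakk> \<Longrightarrow> j < k"
    by metis
  have fin: "finite A" "finite B" using g(2) by (auto simp: A_def B_def)
  have "inj_on f A"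
  proof (rule inj_onI)
    fix k l assume kl: "k \<in> A" "l \<in> A" "f k = f l"
    then show "k = l" using g(5)[of k l u "f k"] f(1)[of k] f(1)[of l] by (auto simp: A_def)
  qed
  moreover have "inj_on h B"
  proof (rule inj_onI)
    fix k l assume kl: "k \<in> B" "l \<in> B" "h k = h l"
    then show "k = l" using g(5)[of k l v "h k"] h(1)[of k] h(1)[of l] by (auto simp: B_def)
  qed
  moreover have "f ` A \<inter> h ` B = {}"
  proof (rule ccontr)
    assume "f ` A \<inter> h ` B \<noteq> {}"
    then obtain k l where kl: "k \<in> A" "l \<in> B" "f k = h l" by auto
    have "l < k" using f(2)[of k l] h(1)[of l] kl by (auto simp: B_def)
    moreover have "k < l" using h(2)[of l k] f(1)[of k] kl by (auto simp: A_def)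
    ultimately show False by simp
  qed
  ultimately have "card A + card B = card (f ` A \<union> h ` B)"
    using fin by (simp add: card_Un_disjoint card_image)
  also have "f ` A \<union> h ` B \<subseteq> V - {u, v}"
    using f(1) h(1) g(3) unfolding A_def B_def by fastforce
  then have "card (f ` A \<union> h ` B) \<le> card (V - {u, v})"
    using g(1) by (intro card_mono) auto
  also have "\<dots> = card V - 2"
    using g(3)[OF i(1)] i g(1) by (subst card_Diff_subset) auto
  finally have "card A + card B \<le> card V - 2" .
  moreover have "card {u, v} \<le> card V"
    using g(1) g(3)[OF i(1)] i(2) by (intro card_mono) auto
  moreover have "degree K Q u = card A + 1" "degree K Q v = card B + 1"
    using i g(2) card_Suc_Diff1[of "{k \<in> K. u \<in> Q k}" i] card_Suc_Diff1[of "{k \<in> K. v \<in> Q k}" i]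
    by (auto simp: degree_def A_def B_def)
  ultimately show ?thesis using i(3) by simp
qed

lemma degree_no_two_clique:
  assumes sys: "greedy_system V K Q" and big: "\<And>k. k \<in> K \<Longrightarrow> 3 \<le> card (Q k)" and x: "x \<in> V"
  shows "2 * degree K Q x \<le> card V - 1"
proof -
  note g = greedy_systemD[OF sys]
  define A where "A = {k \<in> K. x \<in> Q k}"
  have fin: "finite (Q k)" if "k \<in> K" for k using g(1,3) that finite_subset by blast
  have "2 * card A = (\<Sum>k\<in>A. 2)" by simp
  also have "\<dots> \<le> (\<Sum>k\<in>A. card (Q k - {x}))"
  proof (rule sum_mono)
    fix k assume "k \<in> A"
    then show "2 \<le> card (Q k - {x})" using big[of k] fin[of k] by (auto simp: A_def)
  qed
  also have "\<dots> = card (\<Union>k\<in>A. Q k - {x})"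
  proof (rule card_UN_disjoint[symmetric])
    show "finite A" using g(2) by (simp add: A_def)
    show "\<forall>k\<in>A. finite (Q k - {x})" using fin by (simp add: A_def)
    show "\<forall>k\<in>A. \<forall>l\<in>A. k \<noteq> l \<longrightarrow> (Q k - {x}) \<inter> (Q l - {x}) = {}"
    proof (intro ballI impI)
      fix k l assume "k \<in> A" "l \<in> A" "k \<noteq> l"
      then show "(Q k - {x}) \<inter> (Q l - {x}) = {}" using g(5)[of k l x] by (auto simp: A_def)
    qed
  qed
  also have "\<dots> \<le> card (V - {x})"
    using g(1,3) by (intro card_mono) (auto simp: A_def)
  also have "\<dots> = card V - 1" using x g(1) by simp
  finally show ?thesis by (simp add: degree_def A_def)
qed

lemma exists_low_degree:
  assumes sys: "greedy_system V K Q" and "V \<noteq> {}"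
  shows "\<exists>x\<in>V. degree K Q x \<le> card V div 2"
proof (cases "\<exists>i\<in>K. card (Q i) = 2")
  case True
  then obtain i u v where i: "i \<in> K" "Q i = {u, v}" "u \<noteq> v" by (auto simp: card_2_iff)
  then have "u \<in> V" "v \<in> V" using greedy_systemD(3)[OF sys, of i] by auto
  moreover have "degree K Q u \<le> card V div 2 \<or> degree K Q v \<le> card V div 2"
    using degree_sum_two_clique[OF sys i] by linarith
  ultimately show ?thesis by blast
next
  case False
  obtain x where x: "x \<in> V" using assms(2) by blast
  have "3 \<le> card (Q k)" if "k \<in> K" for k
    using greedy_systemD(4)[OF sys that] False that by (cases "card (Q k) = 2") auto
  then have "2 * degree K Q x \<le> card V - 1" using degree_no_two_clique[OF sys _ x] by blast
  then have "degree K Q x \<le> card V div 2" by linarith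
  then show ?thesis using x by blast
qed

lemma Suc_square_div_4: "n\<^sup>2 div 4 + Suc n div 2 = (Suc n)\<^sup>2 div 4" for n :: nat
proof (cases "even n")
  case True
  then obtain m where "n = 2 * m" by auto
  then have "n\<^sup>2 = 4 * m\<^sup>2" "(Suc n)\<^sup>2 = 1 + 4 * (m\<^sup>2 + m)" "Suc n div 2 = m"
    by (auto simp: power2_eq_square algebra_simps)
  then show ?thesis by simp
next
  case False
  then obtain m where "n = 2 * m + 1" by (auto elim: oddE)
  then have "n\<^sup>2 = 1 + 4 * (m\<^sup>2 + m)" "(Suc n)\<^sup>2 = 4 * (m\<^sup>2 + 2 * m + 1)" "Suc n div 2 = m + 1"
    by (auto simp: power2_eq_square algebra_simps)
  then show ?thesis by simp
qed

text \<open>Deleting a vertex of low degree with all its cliques costs at most \<open>n div 2\<close> cliques, which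
  is exactly the growth of the bound.\<close>

lemma card_greedy_system_le:
  assumes "greedy_system V K Q"
  shows "card K \<le> (card V)\<^sup>2 div 4"
  using assms
proof (induction "card V" arbitrary: V K)
  case 0
  note g = greedy_systemD[OF 0(2)]
  have "V = {}" using 0(1) g(1) by simp
  then have "K = {}" using g(3,4) by fastforce
  then show ?case by simp
next
  case (Suc n)
  note g = greedy_systemD[OF Suc.prems]
  have "V \<noteq> {}" using Suc.hyps(2) by auto
  then obtain x where x: "x \<in> V" "degree K Q x \<le> card V div 2"
    using exists_low_degree[OF Suc.prems] by blast
  let ?K = "{k \<in> K. x \<notin> Q k}"
  have n: "n = card (V - {x})" using Suc.hyps(2) x(1) g(1) by simp
  have "greedy_system (V - {x}) ?K Q"
    using Suc.prems by (rule greedy_system_subsystem) (use g(3) in auto)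
  then have "card ?K \<le> n\<^sup>2 div 4" using Suc.hyps(1)[OF n] n by simp
  moreover have "card K = card ?K + degree K Q x"
    unfolding degree_def using g(2) by (subst card_Un_disjoint[symmetric]) (auto intro: arg_cong[of _ _ card])
  ultimately have "card K \<le> n\<^sup>2 div 4 + Suc n div 2" using x(2) Suc.hyps(2) by simp
  then show ?case using Suc_square_div_4[of n] Suc.hyps(2) by simp
qed

section \<open>The two kinds of cliques of a greedy clique decomposition\<close>

definition private_vertices :: "'a set \<Rightarrow> 'a set list \<Rightarrow> 'a set" where
  "private_vertices V Qs = {v \<in> V. \<exists>!k. k < length Qs \<and> v \<in> Qs ! k}"

lemma clique_partition_unique_index:
  assumes P: "clique_partition V E (set Qs)" and d: "distinct Qs"
    and ij: "i < length Qs" "j < length Qs" "u \<in> Qs ! i" "u \<in> Qs ! j" "v \<in> Qs ! i" "v \<in> Qs ! j"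
    and uv: "u \<noteq> v"
  shows "i = j"
proof -
  have "clique V E (Qs ! i)" using P ij(1) by (auto simp: clique_partition_def)
  then have "u \<in> V" "v \<in> V" "{u, v} \<in> E" using ij uv by (auto simp: clique_def)
  then have "\<exists>!Q. Q \<in> set Qs \<and> u \<in> Q \<and> v \<in> Q" using P unfolding clique_partition_def by blast
  then have "Qs ! i = Qs ! j" using ij by (metis nth_mem)
  then show ?thesis using d ij by (simp add: nth_eq_iff_index_eq)
qed

text \<open>A trivial clique is an isolated vertex, hence private, so avoiding the private vertices
  leaves only nontrivial cliques, the ones that were chosen to be maximal.\<close>

lemma greedy_system_no_private:
  assumes G: "simple_graph V E" and Q: "greedy_clique_decomposition V E Qs"
  shows "greedy_system (V - private_vertices V Qs)
    {k. k < length Qs \<and> Qs ! k \<inter> private_vertices V Qs = {}} ((!) Qs)"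
    (is "greedy_system (V - ?U) ?K _")
proof -
  have P: "clique_partition V E (set Qs)" and d: "distinct Qs"
    and mx: "\<And>i. i < length Qs \<Longrightarrow> \<not> trivial_clique (Qs ! i) \<Longrightarrow>
      maximal_clique V (E - (\<Union>j<i. clique_edges E (Qs ! j))) (Qs ! i)"
    and tr: "\<And>Q. Q \<in> set Qs \<Longrightarrow> trivial_clique Q \<Longrightarrow> \<exists>v. isolated V E v \<and> Q = {v}"
    using Q by (auto simp: greedy_clique_decomposition_def)
  have finV: "finite V" using G by (simp add: simple_graph_def)
  have cl: "clique V E (Qs ! k)" if "k < length Qs" for k
    using P that by (auto simp: clique_partition_def)
  have uniq: "i = j" if "i < length Qs" "j < length Qs" "u \<in> Qs ! i" "u \<in> Qs ! j"
    "v \<in> Qs ! i" "v \<in> Qs ! j" "u \<noteq> v" for i j u v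
    using clique_partition_unique_index[OF P d that] .
  have nontriv: "\<not> trivial_clique (Qs ! k)" if k: "k \<in> ?K" for k
  proof
    assume "trivial_clique (Qs ! k)"
    then obtain v where v: "isolated V E v" "Qs ! k = {v}" using tr[of "Qs ! k"] k by auto
    have "j = k" if j: "j < length Qs" "v \<in> Qs ! j" for j
    proof -
      have "Qs ! j \<subseteq> {v}"
        using cl[OF j(1)] j(2) v(1) unfolding clique_def isolated_def by blast
      then have "Qs ! j = Qs ! k" using j(2) unfolding v(2) by blast
      then show ?thesis using nth_eq_iff_index_eq[OF d j(1)] k by blast
    qed
    moreover have "v \<in> V" "k < length Qs" "v \<in> Qs ! k"
      using k v by (simp_all add: isolated_def)
    ultimately have "v \<in> ?U" unfolding private_vertices_def by blast
    then show False using k v by auto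
  qed
  have two: "2 \<le> card (Qs ! k)" if k: "k \<in> ?K" for k
  proof -
    have "Qs ! k \<subseteq> V" "Qs ! k \<noteq> {}" using cl[of k] k by (simp_all add: clique_def)
    then have "card (Qs ! k) \<noteq> 0" using finite_subset[OF _ finV] by simp
    then show ?thesis using nontriv[OF k] by (simp add: trivial_clique_def)
  qed
  have maximal: "\<exists>x\<in>Qs ! i. \<forall>j\<in>?K. w \<in> Qs ! j \<and> x \<in> Qs ! j \<longrightarrow> j < i"
    if i: "i \<in> ?K" and w: "w \<in> V - ?U - Qs ! i" for i w
  proof (rule ccontr)
    assume "\<not> ?thesis"
    then have a: "\<exists>j. j < length Qs \<and> i \<le> j \<and> w \<in> Qs ! j \<and> x \<in> Qs ! j" if "x \<in> Qs ! i" for x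
      using that by (auto simp: not_less)
    let ?E = "E - (\<Union>j<i. clique_edges E (Qs ! j))"
    have mi: "maximal_clique V ?E (Qs ! i)" using mx nontriv[OF i] i by simp
    have wx: "{w, x} \<in> ?E" if x: "x \<in> Qs ! i" for x
    proof -
      obtain j where j: "j < length Qs" "i \<le> j" "w \<in> Qs ! j" "x \<in> Qs ! j" using a[OF x] by blast
      have ne: "w \<noteq> x" using w x by auto
      have "{w, x} \<in> E" using cl[OF j(1)] j ne by (auto simp: clique_def)
      moreover have "{w, x} \<notin> clique_edges E (Qs ! l)" if "l < i" for l
        using uniq[of l j w x] j ne that i by (auto simp: clique_edges_def)
      ultimately show ?thesis by blast
    qed
    moreover have "clique V ?E (Qs ! i)" using mi by (simp add: maximal_clique_def)
    ultimately have "clique V ?E (insert w (Qs ! i))"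
      using w unfolding clique_def by (auto simp: insert_commute)
    then have "insert w (Qs ! i) = Qs ! i"
      using mi unfolding maximal_clique_def by blast
    then show False using w by auto
  qed
  show ?thesis unfolding greedy_system_def
  proof (intro conjI ballI allI impI)
    show "finite (V - ?U)" "finite ?K" using finV by auto
    show "Qs ! k \<subseteq> V - ?U" if "k \<in> ?K" for k using cl[of k] that by (auto simp: clique_def)
    show "2 \<le> card (Qs ! k)" if "k \<in> ?K" for k using two that .
    show "i = j" if "i \<in> ?K" "j \<in> ?K"
      "u \<in> Qs ! i \<inter> Qs ! j \<and> v \<in> Qs ! i \<inter> Qs ! j \<and> u \<noteq> v" for i j u v
      using uniq[of i j u v] that by auto
  qed (use maximal in blast)
qed

text \<open>Every clique with a private vertex has one that is not chosen for attachment, so these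
  cliques and the chosen vertices together inject into the private vertices.\<close>

lemma card_elements_attach_le:
  assumes G: "simple_graph V E" and Q: "greedy_clique_decomposition V E Qs"
    and e: "inj_on e {..<length Qs}" and F: "attach_monopolized V (clique_family e Qs) F"
  shows "card (elements V F) \<le> card (private_vertices V Qs) +
    card {k. k < length Qs \<and> Qs ! k \<inter> private_vertices V Qs = {}}"
    (is "_ \<le> card ?U + card ?K")
proof -
  let ?S = "clique_family e Qs"
  let ?m = "length Qs"
  have finV: "finite V" using G by (simp add: simple_graph_def)
  have rep: "multifamily_representation V E ?S"
    by (rule multifamily_representation_clique_family[OF G Q e])
  from F obtain C a where C: "C \<subseteq> V"
    and c': "\<forall>v\<in>V. card {u \<in> C. ?S u = ?S v} = card {u \<in> V. ?S u = ?S v} - 1"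
    and F': "\<forall>v\<in>V. F v = (if v \<in> C then insert (a v) (?S v) else ?S v)"
    unfolding attach_monopolized_def by (elim exE conjE)
  note c = bspec[OF c']
  have finC: "finite C" using C finV finite_subset by blast
  have mem: "e k \<in> ?S v \<longleftrightarrow> v \<in> Qs ! k" if "k < ?m" for k v
    using e that by (auto simp: clique_family_def inj_on_def)
  have sing: "v \<in> ?U \<longleftrightarrow> (\<exists>k<?m. ?S v = {e k})" if v: "v \<in> V" for v
  proof
    assume "v \<in> ?U"
    then obtain k where k: "k < ?m" "v \<in> Qs ! k" "\<And>l. l < ?m \<Longrightarrow> v \<in> Qs ! l \<Longrightarrow> l = k"
      unfolding private_vertices_def by blast
    then have "?S v = {e k}" unfolding clique_family_def by blast
    then show "\<exists>k<?m. ?S v = {e k}" using k by blast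
  next
    assume "\<exists>k<?m. ?S v = {e k}"
    then obtain k where k: "k < ?m" "?S v = {e k}" by blast
    have "l = k" if "l < ?m" "v \<in> Qs ! l" for l
      using mem[OF that(1), of v] that k e by (auto simp: inj_on_def)
    moreover have "v \<in> Qs ! k" using mem[OF k(1), of v] k(2) by auto
    ultimately show "v \<in> ?U" using v k(1) by (auto simp: private_vertices_def)
  qed
  have CU: "C \<subseteq> ?U"
  proof
    fix v assume v: "v \<in> C"
    then have vV: "v \<in> V" using C by blast
    have "0 < card {u \<in> C. ?S u = ?S v}" using v finC by (auto simp: card_gt_0_iff)
    then have "\<not> {u \<in> V. ?S u = ?S v} \<subseteq> {v}"
      using c[OF vV] card_mono[of "{v}" "{u \<in> V. ?S u = ?S v}"] by auto
    then obtain u where u: "u \<in> V" "u \<noteq> v" "?S u = ?S v" by blast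
    have "card (?S u \<inter> ?S v) = (if {u, v} \<in> E then 1 else 0)"
      using rep u vV unfolding multifamily_representation_def by blast
    then have "card (?S v) \<le> 1" using u(3) by (simp split: if_splits)
    moreover have "card (?S v) \<noteq> 0"
      using rep vV by (simp add: multifamily_representation_def)
    ultimately have "card (?S v) = 1" by simp
    then obtain y where y: "?S v = {y}" by (auto simp: card_1_singleton_iff)
    then have "y \<in> ?S v" by simp
    then obtain k where "k < ?m" "y = e k" unfolding clique_family_def by blast
    then show "v \<in> ?U" using sing[OF vV] y by blast
  qed
  let ?L = "{k. k < ?m \<and> Qs ! k \<inter> ?U \<noteq> {}}"
  have "\<forall>k\<in>?L. \<exists>u. u \<in> ?U - C \<and> ?S u = {e k}"
  proof
    fix k assume k: "k \<in> ?L"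
    obtain v where v: "v \<in> ?U" "v \<in> Qs ! k" using k by blast
    then have vV: "v \<in> V" by (simp add: private_vertices_def)
    have Sv: "?S v = {e k}"
      using v vV sing[OF vV] mem[of k v] k by auto
    have "0 < card {u \<in> V. ?S u = ?S v}"
      using vV finV by (auto simp: card_gt_0_iff)
    then have "card {u \<in> C. ?S u = ?S v} \<noteq> card {u \<in> V. ?S u = ?S v}" using c[OF vV] by linarith
    then have "{u \<in> C. ?S u = ?S v} \<noteq> {u \<in> V. ?S u = ?S v}" by metis
    then obtain u where "u \<in> V - C" "?S u = ?S v" using C by blast
    moreover have "u \<in> ?U" using calculation sing[of u] Sv k by auto
    ultimately show "\<exists>u. u \<in> ?U - C \<and> ?S u = {e k}" using Sv by auto
  qed
  from bchoice[OF this] obtain r where r': "\<forall>k\<in>?L. r k \<in> ?U - C \<and> ?S (r k) = {e k}" ..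
  then have r: "r k \<in> ?U - C" "?S (r k) = {e k}" if "k \<in> ?L" for k
    using that by blast+
  have finU: "finite ?U" using finV by (simp add: private_vertices_def)
  have "inj_on r ?L"
  proof (rule inj_onI)
    fix k l assume kl: "k \<in> ?L" "l \<in> ?L" "r k = r l"
    then have "e k = e l" using r(2)[of k] r(2)[of l] by simp
    then show "k = l" using e kl by (auto simp: inj_on_def)
  qed
  then have "card ?L \<le> card (?U - C)"
    using r(1) finU by (intro card_inj_on_le[of r]) auto
  then have L: "card ?L + card C \<le> card ?U"
    using CU finC finU card_mono[OF finU CU] by (simp add: card_Diff_subset)
  have "{..<?m} = ?K \<union> ?L" by auto
  then have m: "?m \<le> card ?K + card ?L"
    using card_Un_le[of ?K ?L] by (metis card_lessThan)
  have "elements V F \<subseteq> e ` {..<?m} \<union> a ` C"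
    using F' by (fastforce simp: elements_def clique_family_def split: if_splits)
  then have "card (elements V F) \<le> card (e ` {..<?m} \<union> a ` C)"
    using finC by (intro card_mono) auto
  also have "\<dots> \<le> card (e ` {..<?m}) + card (a ` C)" by (rule card_Un_le)
  also have "\<dots> \<le> ?m + card C"
    using card_image_le[of "{..<?m}" e] card_image_le[OF finC, of a] by simp
  finally show ?thesis using L m by simp
qed

section \<open>The bound on the number of elements\<close>

lemma add_square_div_4_le:
  fixes u w :: nat
  assumes "4 \<le> u + w"
  shows "u + w\<^sup>2 div 4 \<le> (u + w)\<^sup>2 div 4"
proof -
  have "u * 4 \<le> u * (u + 2 * w)" using assms by (intro mult_le_mono2) simp
  then have "w\<^sup>2 + u * 4 \<le> (u + w)\<^sup>2" by (simp add: power2_eq_square algebra_simps)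
  then have "(w\<^sup>2 + u * 4) div 4 \<le> (u + w)\<^sup>2 div 4" by (rule div_le_mono)
  then show ?thesis by simp
qed

theorem theorem3p2:
  fixes V :: "'a set" and E :: "'a set set" and n :: nat
    and Qs :: "'a set list" and e :: "nat \<Rightarrow> 'b" and F :: "'a \<Rightarrow> 'b set"
  assumes "simple_graph V E" and "card V = n" and "n \<ge> 4"
    and "greedy_clique_decomposition V E Qs"
    and "inj_on e {..<length Qs}"
    and "representation V E F"
    and "attach_monopolized V (clique_family e Qs) F"
  shows "card (elements V F) \<le> n\<^sup>2 div 4"
proof -
  let ?U = "private_vertices V Qs"
  let ?K = "{k. k < length Qs \<and> Qs ! k \<inter> ?U = {}}"
  have U: "?U \<subseteq> V" by (auto simp: private_vertices_def)
  have fin: "finite V" using assms(1) by (simp add: simple_graph_def)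
  have n: "card ?U + card (V - ?U) = n"
    using U fin assms(2) card_mono[OF fin U] finite_subset[OF U fin] by (simp add: card_Diff_subset)
  have "card (elements V F) \<le> card ?U + card ?K"
    by (rule card_elements_attach_le[OF assms(1,4,5,7)])
  also have "\<dots> \<le> card ?U + (card (V - ?U))\<^sup>2 div 4"
    using card_greedy_system_le[OF greedy_system_no_private[OF assms(1,4)]] by simp
  also have "\<dots> \<le> n\<^sup>2 div 4"
    using add_square_div_4_le[of "card ?U" "card (V - ?U)"] n assms(3) by simp
  finally show ?thesis .
qed

end
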